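(* For fixed $t\in\mathbb{R}$, let $\mathrm{p}(n,t)$ be the coefficient of $x^{n-2}$ in the monic orthogonal polynomial $P_n(x;t)$ of degree $n$ with respect to the weight $w(x;t)=\mathrm{e}^{-x^4+tx^2}$ on $\mathbb{R}$. Then, as $n\to\infty$, \begin{align*} \mathrm{p}(n,t)=&-\frac{n^{3/2}}{3\sqrt{3}}-\frac{nt}{12}-\frac{(t^2-6)\,n^{1/2}}{24\sqrt{3}}-\frac{t(t^2-9)}{216}-\frac{t^4-12t^2-24}{1152\sqrt{3}\,n^{1/2}}\\ &+\frac{t}{288n}+\frac{t^6-18t^4-72t^2+864}{82944\sqrt{3}\,n^{3/2}}-\frac{t(t^2-6)}{3456n^2}+O\big(n^{-5/2}\big). \end{align*}
   Context: For $t\in\mathbb{R}$, let $P_n(x;t)$, $n=0,1,2,\ldots$, be the monic polynomials of degree $n$ orthogonal with respect to $w(x;t)=\mathrm{e}^{-x^4+tx^2}$ on $\mathbb{R}$: $\int_{-\infty}^{\infty}P_j(x;t)P_k(x;t)w(x;t)\,dx=h_j(t)\delta_{jk}$ with $h_j(t)>0$. Since the weight is even, $P_n(-x;t)=(-1)^nP_n(x;t)$, so $P_n(x;t)=x^n+\mathrm{p}(n,t)x^{n-2}+\cdots$, with $\mathrm{p}(0,t)=\mathrm{p}(1,t)=0$. The implied constant in the $O$-term may depend on $t$. *)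

theory Defs
  imports
    "HOL-Analysis.Analysis"
    "HOL-Computational_Algebra.Polynomial"
    "HOL-Library.Landau_Symbols"
begin

definition quartic_weight :: "real \<Rightarrow> real \<Rightarrow> real" where
  "quartic_weight t x = exp (- (x ^ 4) + t * x ^ 2)"

text \<open>
  Orthogonality is stated with \<^const>\<open>has_bochner_integral\<close>, so that it includes integrability;
  the Bochner integral of a non-integrable function would be \<open>0\<close> by convention.
\<close>

definition monic_orthogonal_polys :: "(real \<Rightarrow> real) \<Rightarrow> (nat \<Rightarrow> real poly) \<Rightarrow> bool" where
  "monic_orthogonal_polys w P \<longleftrightarrow>
     (\<forall>n. degree (P n) = n \<and> lead_coeff (P n) = 1) \<and>
     (\<exists>h. (\<forall>j. h j > 0) \<and>
        (\<forall>j k. has_bochner_integral lborel (\<lambda>x. poly (P j) x * poly (P k) x * w x)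
                 (if j = k then h j else 0)))"

text \<open>
  The cases \<open>n = 0\<close> and \<open>n = 1\<close> are set to \<open>0\<close> explicitly, since \<open>n - 2\<close> is truncated
  on natural numbers.
\<close>

definition subleading_coeff :: "(nat \<Rightarrow> real poly) \<Rightarrow> nat \<Rightarrow> real" where
  "subleading_coeff P n = (if n < 2 then 0 else coeff (P n) (n - 2))"

end

theory Submission
  imports Defs "HOL-Real_Asymp.Real_Asymp"
begin

text \<open>
  Let \<open>\<beta>\<^sub>n = h\<^sub>n / h\<^sub>n\<^sub>-\<^sub>1\<close> be the recurrence coefficients. Integration by parts gives the Freud equation
  \<open>4 \<beta>\<^sub>n (\<beta>\<^sub>n\<^sub>+\<^sub>1 + \<beta>\<^sub>n + \<beta>\<^sub>n\<^sub>-\<^sub>1) - 2 t \<beta>\<^sub>n = n\<close>, and comparing \<open>P'\<^sub>n\<^sub>+\<^sub>1\<close> with \<open>P\<^sub>n\<^sub>-\<^sub>2\<close> gives the closed form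
  \<open>p(n,t) = - \<beta>\<^sub>n ((n - 1) / 2 + 2 \<beta>\<^sub>n\<^sub>+\<^sub>1 \<beta>\<^sub>n\<^sub>-\<^sub>1)\<close>, which also determines the constant term that is lost in
  an asymptotic summation of \<open>p(n,t) - p(n+1,t) = \<beta>\<^sub>n\<close>. Positivity of \<open>\<beta>\<close> forces \<open>\<beta>\<^sub>n \<sim> sqrt (n / 12)\<close>. The error \<open>e\<close> of a truncated formal
  solution then satisfies \<open>e\<^sub>n = - (1/4 + o(1)) (e\<^sub>n\<^sub>+\<^sub>1 + e\<^sub>n\<^sub>-\<^sub>1) + O(n\<^sup>-\<^sup>7\<^sup>/\<^sup>2)\<close>; as \<open>1/4 < 1/2\<close>, a maximum
  principle yields \<open>e\<^sub>n = O(n\<^sup>-\<^sup>7\<^sup>/\<^sup>2)\<close>.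
\<close>

section \<open>Orthogonal polynomials for an even quartic weight\<close>

text \<open>\<open>L\<close> stands for integration against the weight. The algebra below needs only
  linearity, evenness and \<open>L_pderiv\<close>, which is integration by parts: 4x^3 - 2tx is
  minus the logarithmic derivative of the weight.\<close>

locale even_quartic_functional =
  fixes L :: "real poly \<Rightarrow> real" and t :: real and P :: "nat \<Rightarrow> real poly" and h :: "nat \<Rightarrow> real"
  assumes L_add: "L (p + q) = L p + L q"
    and L_smult: "L (smult c p) = c * L p"
    and L_even: "L (pcompose p [:0, -1:]) = L p"
    and L_pderiv: "L (pderiv p) = L (p * (smult 4 ([:0, 1:] ^ 3) - smult (2 * t) [:0, 1:]))"
    and degree_P: "degree (P n) = n"
    and monic_P: "coeff (P n) n = 1"
    and L_P_P: "L (P j * P k) = (if j = k then h j else 0)"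
    and h_pos: "h n > 0"
begin

section \<open>Expansion along the orthogonal polynomials\<close>

lemma L_0: "L 0 = 0"
  using L_smult[of 0 0] by simp

lemma L_diff: "L (p - q) = L p - L q"
  using L_add[of p "smult (-1) q"] L_smult[of "-1" q] by simp

lemma coeff_P_eq_0: "i > n \<Longrightarrow> coeff (P n) i = 0"
  by (simp add: coeff_eq_0 degree_P)

text \<open>Subtracting a multiple of \<open>P m\<close> kills the top coefficient of
  \<open>q\<close>, so induction on the degree bound applies. Bounding coefficients instead of the
  degree treats \<open>q = 0\<close> and \<open>m = 0\<close> uniformly.\<close>

lemma L_mult_eq_0:
  assumes "\<And>i. i \<ge> m \<Longrightarrow> coeff q i = 0" and "\<And>k. k < m \<Longrightarrow> L (f * P k) = 0"
  shows "L (f * q) = 0"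
  using assms
proof (induction m arbitrary: q)
  case 0
  then have "q = 0" by (simp add: poly_eq_iff)
  then show ?case by (simp add: L_0)
next
  case (Suc m)
  let ?r = "q - smult (coeff q m) (P m)"
  have "L (f * ?r) = 0"
  proof (rule Suc.IH)
    fix i assume "m \<le> i"
    then show "coeff ?r i = 0"
      using Suc.prems(1)[of i] coeff_P_eq_0[of m i] monic_P[of m] by (cases "i = m") auto
  qed (use Suc.prems in auto)
  then show ?case using Suc.prems(2)[of m] by (simp add: right_diff_distrib L_diff L_smult)
qed

lemma L_P_mult_eq_0:
  assumes "\<And>i. i \<ge> n \<Longrightarrow> coeff q i = 0"
  shows "L (P n * q) = 0"
  using assms by (rule L_mult_eq_0) (auto simp: L_P_P)

text \<open>Only the component of \<open>q\<close> along \<open>P n\<close> survives orthogonality.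
  Pairing with \<open>P n\<close> thus amounts to reading off one coefficient, which is how nearly
  all inner products below are computed.\<close>

lemma L_P_mult:
  assumes "\<And>i. i > n \<Longrightarrow> coeff q i = 0"
  shows "L (P n * q) = coeff q n * h n"
proof -
  let ?r = "q - smult (coeff q n) (P n)"
  have "L (P n * ?r) = 0"
  proof (rule L_P_mult_eq_0)
    fix i assume "n \<le> i"
    then show "coeff ?r i = 0"
      using assms[of i] coeff_P_eq_0[of n i] monic_P[of n] by (cases "i = n") auto
  qed
  then show ?thesis by (simp add: right_diff_distrib L_diff L_smult L_P_P)
qed

text \<open>Pairing \<open>q\<close> with \<open>P (degree q)\<close> gives its leading coefficient
  times a positive number. This uniqueness principle yields both parity and the three-term
  recurrence.\<close>

lemma eq_0_if_orthogonal:
  assumes "\<And>i. i \<ge> m \<Longrightarrow> coeff q i = 0" and "\<And>k. k < m \<Longrightarrow> L (q * P k) = 0"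
  shows "q = 0"
proof (rule ccontr)
  assume "q \<noteq> 0"
  then have "degree q < m" using assms(1)[of "degree q"] by (meson leading_coeff_0_iff not_le)
  moreover have "L (P (degree q) * q) = lead_coeff q * h (degree q)"
    by (rule L_P_mult) (simp add: coeff_eq_0)
  ultimately show False
    using assms(2)[of "degree q"] h_pos[of "degree q"] \<open>q \<noteq> 0\<close> by (simp add: mult.commute)
qed

text \<open>Since \<open>L\<close> is even, the reflected polynomial is still orthogonal to all
  lower degrees, and its leading coefficient is (-1)^n.\<close>

lemma P_reflect: "pcompose (P n) [:0, -1:] = smult ((-1) ^ n) (P n)"
proof -
  let ?R = "pcompose (P n) [:0, -1:] - smult ((-1) ^ n) (P n)"
  have "?R = 0"
  proof (rule eq_0_if_orthogonal)
    fix i assume "n \<le> i"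
    then show "coeff ?R i = 0"
      using coeff_P_eq_0[of n i] monic_P[of n] by (cases "i = n") (auto simp: coeff_pcompose_linear)
  next
    fix k assume k: "k < n"
    \<comment> \<open>Reflecting twice is the identity, so \<open>L_even\<close> moves the
      reflection from \<open>P n\<close> onto the lower-degree factor.\<close>
    have "pcompose (P n * pcompose (P k) [:0, -1:]) [:0, -1:] = pcompose (P n) [:0, -1:] * P k"
      by (simp add: pcompose_mult flip: pcompose_assoc) (simp add: pcompose_pCons)
    then have "L (pcompose (P n) [:0, -1:] * P k) = L (P n * pcompose (P k) [:0, -1:])"
      by (metis L_even)
    also have "\<dots> = 0"
      by (rule L_P_mult_eq_0) (use k in \<open>simp add: coeff_pcompose_linear coeff_P_eq_0\<close>)
    finally show "L (?R * P k) = 0" using k by (simp add: left_diff_distrib L_diff L_smult L_P_P)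
  qed
  then show ?thesis by simp
qed

lemma coeff_P_Suc: "coeff (P (Suc n)) n = 0"
proof -
  have "(-1) ^ n * coeff (P (Suc n)) n = (-1) ^ Suc n * coeff (P (Suc n)) n"
    using arg_cong[OF P_reflect[of "Suc n"], of "\<lambda>p. coeff p n"] by (simp add: coeff_pcompose_linear)
  then show ?thesis by simp
qed

text \<open>Since \<open>0 - 1 = 0\<close>, this sets \<open>\<beta> 0 = 1\<close> instead of the conventional \<open>0\<close>.\<close>
definition \<beta> :: "nat \<Rightarrow> real" where "\<beta> n = h n / h (n - 1)"

lemma \<beta>_pos: "\<beta> n > 0"
  by (simp add: \<beta>_def h_pos)

lemma h_Suc: "h (Suc n) = \<beta> (Suc n) * h n"
  using h_pos[of n] by (simp add: \<beta>_def)

text \<open>The remainder has degree at most \<open>n\<close>: the top terms cancel and parity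
  removes the next coefficient. Moving x onto \<open>P k\<close> shows that only
  \<open>k = n\<close> contributes, with value \<open>h (Suc n)\<close>.\<close>

lemma three_term_recurrence:
  "[:0, 1:] * P (Suc n) = P (Suc (Suc n)) + smult (\<beta> (Suc n)) (P n)"
proof -
  let ?R = "[:0, 1:] * P (Suc n) - P (Suc (Suc n)) - smult (\<beta> (Suc n)) (P n)"
  have "?R = 0"
  proof (rule eq_0_if_orthogonal)
    fix i assume i: "Suc n \<le> i"
    consider "i = Suc n" | "i = Suc (Suc n)" | "i > Suc (Suc n)" using i by linarith
    then show "coeff ?R i = 0"
      by cases (auto simp: coeff_pCons coeff_P_eq_0 monic_P coeff_P_Suc split: nat.split)
  next
    fix k assume k: "k < Suc n"
    have "L (P (Suc n) * ([:0, 1:] * P k)) = (if k = n then h (Suc n) else 0)"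
    proof (subst L_P_mult)
      show "coeff ([:0, 1:] * P k) i = 0" if "i > Suc n" for i
        using that k by (auto simp: coeff_pCons coeff_P_eq_0 split: nat.split)
    qed (use k in \<open>auto simp: coeff_P_eq_0 monic_P\<close>)
    then have "L ([:0, 1:] * P (Suc n) * P k) = (if k = n then h (Suc n) else 0)"
      by (simp only: ac_simps)
    then show "L (?R * P k) = 0"
      using k by (auto simp: left_diff_distrib L_diff L_smult L_P_P h_Suc simp del: mult_pCons_left)
  qed
  then show ?thesis by (simp add: algebra_simps)
qed

section \<open>Two consequences of integration by parts\<close>

text \<open>\<open>L\<close> of the derivative of P_N P_{N-1} is computed directly, giving N
  h_{N-1}, and by parts, giving moments that the recurrence expresses through \<beta>. Starting at
  \<open>N = n + 2\<close> keeps the unconventional \<open>\<beta> 0\<close> out.\<close>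

lemma freud_equation:
  fixes n
  defines "N \<equiv> Suc (Suc n)"
  shows "4 * \<beta> N * (\<beta> (Suc N) + \<beta> N + \<beta> (Suc n)) - 2 * t * \<beta> N = real N"
proof -
  define X :: "real poly" where "X = [:0, 1:]"
  let ?Q = "P (Suc n)" and ?P = "P N"
  have rec: "X * P (Suc m) = P (Suc (Suc m)) + smult (\<beta> (Suc m)) (P m)" for m
    unfolding X_def by (rule three_term_recurrence)
  have 1: "L (X * (?P * ?Q)) = h N"
  proof -
    have "X * (?P * ?Q) = ?P * (X * ?Q)" by (simp add: ac_simps)
    then show ?thesis by (simp only: rec distrib_left L_add) (simp add: L_smult L_P_P N_def)
  qed
  have 2: "L ((X * P (Suc m)) * (X * P (Suc m))) = h (Suc (Suc m)) + (\<beta> (Suc m))\<^sup>2 * h m" for m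
    by (simp only: rec distrib_left distrib_right L_add)
      (simp add: L_smult L_P_P power2_eq_square)
  have 3: "L (X ^ 3 * (?P * ?Q)) = h N * (\<beta> (Suc N) + \<beta> N + \<beta> (Suc n))"
  proof -
    have "X ^ 3 * (?P * ?Q) = (X * ?P) * (X * (X * ?Q))" by (simp add: power3_eq_cube ac_simps)
    also have "X * ?P = P (Suc N) + smult (\<beta> N) ?Q" unfolding N_def by (rule rec)
    also have "(P (Suc N) + smult (\<beta> N) ?Q) * (X * (X * ?Q)) =
        P (Suc N) * (X * (X * ?Q)) + smult (\<beta> N) ((X * ?Q) * (X * ?Q))"
      by (simp add: distrib_left distrib_right ac_simps)
    also have "L \<dots> = L (P (Suc N) * (X * (X * ?Q))) + \<beta> N * (h N + (\<beta> (Suc n))\<^sup>2 * h n)"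
      unfolding L_add L_smult 2 N_def ..
    \<comment> \<open>x^2 P_{N-1} is monic of degree N + 1.\<close>
    also have "L (P (Suc N) * (X * (X * ?Q))) = h (Suc N)"
      by (subst L_P_mult) (auto simp: X_def coeff_pCons coeff_P_eq_0 monic_P N_def split: nat.split)
    finally show ?thesis
      by (simp add: h_Suc N_def algebra_simps power2_eq_square)
  qed
  have "L (?P * pderiv ?Q) = 0"
    by (rule L_P_mult_eq_0) (simp add: coeff_pderiv coeff_P_eq_0 N_def)
  moreover have "L (?Q * pderiv ?P) = real N * h (Suc n)"
    by (subst L_P_mult) (auto simp: coeff_pderiv coeff_P_eq_0 monic_P N_def)
  ultimately have "real N * h (Suc n) = L (pderiv (?P * ?Q))"
    by (simp add: pderiv_mult L_add)
  also have "\<dots> = L (smult 4 (X ^ 3 * (?P * ?Q)) - smult (2 * t) (X * (?P * ?Q)))"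
    unfolding L_pderiv X_def by (simp only: right_diff_distrib mult_smult_right ac_simps)
  also have "\<dots> = 4 * (h N * (\<beta> (Suc N) + \<beta> N + \<beta> (Suc n))) - 2 * t * h N"
    by (simp add: L_diff L_smult 1 3)
  also have "h N = \<beta> N * h (Suc n)" by (simp add: h_Suc N_def)
  finally have "h (Suc n) * (4 * \<beta> N * (\<beta> (Suc N) + \<beta> N + \<beta> (Suc n)) - 2 * t * \<beta> N) =
      h (Suc n) * real N"
    by (simp add: algebra_simps)
  then show ?thesis using h_pos[of "Suc n"] by simp
qed

text \<open>The combination \<open>?q\<close> has degree at most \<open>n\<close>, because leading
  terms cancel and parity removes the next one. Pairing it with \<open>P n\<close> therefore reads
  off a combination of the subleading coefficients of P_N and P_{N+1}, which differ by
  \<open>\<beta> N\<close>.\<close>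

lemma coeff_P_eq_\<beta>:
  fixes n
  defines "N \<equiv> Suc (Suc n)"
  shows "coeff (P N) n = - \<beta> N * ((real N - 1) / 2 + 2 * \<beta> (Suc N) * \<beta> (Suc n))"
proof -
  define X :: "real poly" where "X = [:0, 1:]"
  define a where "a = coeff (P (Suc N)) (Suc n)"
  have a: "a = coeff (P N) n - \<beta> N"
    using arg_cong[OF three_term_recurrence[of "Suc n"], of "\<lambda>p. coeff p (Suc n)"]
    by (simp add: a_def N_def monic_P)
  let ?q = "pderiv (P (Suc N)) - smult (real (Suc N)) (P N)"
  have "L (P n * ?q) = coeff ?q n * h n"
  proof (rule L_P_mult)
    fix i assume "n < i"
    then consider "i = Suc n" | "i = N" | "i > N" unfolding N_def by linarith
    then show "coeff ?q i = 0"
      by cases (use coeff_P_Suc[of "N"] coeff_P_Suc[of "Suc n"] in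
        \<open>auto simp: coeff_pderiv coeff_P_eq_0 monic_P N_def\<close>)
  qed
  also have "coeff ?q n = real (Suc n) * a - real (Suc N) * coeff (P N) n"
    by (simp add: coeff_pderiv a_def)
  also have "L (P n * ?q) = L (pderiv (P (Suc N) * P n))"
  proof -
    have "L (P (Suc N) * pderiv (P n)) = 0"
      by (rule L_P_mult_eq_0) (simp add: coeff_pderiv coeff_P_eq_0 N_def)
    then show ?thesis by (simp add: pderiv_mult L_add L_diff L_smult L_P_P right_diff_distrib N_def)
  qed
  also have "\<dots> = L (P (Suc N) * (smult 4 (X * (X * (X * P n))) - smult (2 * t) (X * P n)))"
    unfolding L_pderiv X_def
    by (simp only: right_diff_distrib mult_smult_right ac_simps power3_eq_cube)
  \<comment> \<open>Only the leading term of 4x^3 P_n reaches degree N + 1; the part with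
    \<open>t\<close> has too low a degree.\<close>
  also have "\<dots> = 4 * h (Suc N)"
    by (subst L_P_mult) (auto simp: X_def coeff_pCons coeff_P_eq_0 monic_P N_def split: nat.split)
  also have "h (Suc N) = \<beta> (Suc N) * \<beta> N * \<beta> (Suc n) * h n"
    by (simp add: h_Suc N_def)
  finally have "4 * (\<beta> (Suc N) * \<beta> N * \<beta> (Suc n)) =
      real (Suc n) * (coeff (P N) n - \<beta> N) - real (Suc N) * coeff (P N) n"
    using h_pos[of n] by (simp add: a)
  then show ?thesis by (simp add: N_def field_simps)
qed

end

section \<open>Integration against the quartic weight\<close>

lemma quartic_weight_minus [simp]: "quartic_weight t (- x) = quartic_weight t x"
  by (simp add: quartic_weight_def)

text \<open>The \<open>P n\<close> span all polynomials, so removing leading terms one at a time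
  reduces integrability to theirs; no estimate of \<open>w\<close> is involved.\<close>

lemma integrable_poly_times:
  fixes P :: "nat \<Rightarrow> real poly" and w :: "real \<Rightarrow> real"
  assumes "\<And>n. degree (P n) = n" and "\<And>n. coeff (P n) n = 1"
    and "\<And>n. integrable lborel (\<lambda>x. poly (P n) x * w x)"
  shows "integrable lborel (\<lambda>x. poly q x * w x)"
proof (induction "degree q" arbitrary: q rule: less_induct)
  case less
  show ?case
  proof (cases "degree q = 0")
    case True
    then obtain c where "q = [:c:]" using degree_0_id by metis
    moreover obtain d where "P 0 = [:d:]" using degree_0_id assms(1)[of 0] by metis
    ultimately show ?thesis using assms(2,3)[of 0] by auto
  next
    case False
    let ?r = "q - smult (lead_coeff q) (P (degree q))"
    have "degree ?r < degree q"
    proof -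
      have "degree ?r \<le> degree q" by (rule degree_diff_le) (auto simp: assms(1))
      moreover have "degree ?r \<noteq> degree q"
      proof
        assume deg: "degree ?r = degree q"
        have "coeff ?r (degree q) = 0" by (simp add: assms(2))
        then have "?r = 0" using deg by (metis leading_coeff_0_iff)
        then show False using deg False by simp
      qed
      ultimately show ?thesis by simp
    qed
    then have "integrable lborel (\<lambda>x. poly ?r x * w x)" by (rule less)
    then have "integrable lborel
        (\<lambda>x. poly ?r x * w x + lead_coeff q * (poly (P (degree q)) x * w x))"
      by (intro Bochner_Integration.integrable_add integrable_mult_right assms)
    then show ?thesis by (simp add: algebra_simps)
  qed
qed

text \<open>A factor exp x is shifted between the two: \<open>q\<close> divided by exp x tends to 0,
  and so does the weight times exp x.\<close>

lemma poly_times_quartic_weight_at_top: "((\<lambda>x. poly q x * quartic_weight t x) \<longlongrightarrow> 0) at_top"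
proof -
  have "((\<lambda>x. \<Sum>i\<le>degree q. coeff q i * (x ^ i / exp x)) \<longlongrightarrow> (\<Sum>i\<le>degree q. coeff q i * 0)) at_top"
    by (intro tendsto_intros tendsto_power_div_exp_0)
  moreover have "((\<lambda>x. exp (- (x ^ 4) + t * x ^ 2 + x)) \<longlongrightarrow> 0) at_top"
    by real_asymp
  ultimately have "((\<lambda>x. (\<Sum>i\<le>degree q. coeff q i * (x ^ i / exp x)) *
      exp (- (x ^ 4) + t * x ^ 2 + x)) \<longlongrightarrow> (\<Sum>i\<le>degree q. coeff q i * 0) * 0) at_top"
    by (rule tendsto_mult)
  moreover have "(\<Sum>i\<le>degree q. coeff q i * (x ^ i / exp x)) * exp (- (x ^ 4) + t * x ^ 2 + x) =
      poly q x * quartic_weight t x" for x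
    by (simp add: poly_altdef quartic_weight_def exp_add sum_divide_distrib[symmetric])
  ultimately show ?thesis by simp
qed

lemma poly_times_quartic_weight_at_bot: "((\<lambda>x. poly q x * quartic_weight t x) \<longlongrightarrow> 0) at_bot"
  using poly_times_quartic_weight_at_top[of "pcompose q [:0, -1:]" t]
  by (simp add: filterlim_at_bot_mirror poly_pcompose)

text \<open>The integrand \<open>?f\<close> is the derivative of \<open>q\<close> times the weight,
  whose boundary values at both infinities vanish.\<close>

lemma integral_quartic_weight_by_parts:
  assumes "\<And>q. integrable lborel (\<lambda>x. poly q x * quartic_weight t x)"
  shows "(\<integral>x. poly (pderiv q) x * quartic_weight t x \<partial>lborel) =
    (\<integral>x. poly (q * (smult 4 ([:0, 1:] ^ 3) - smult (2 * t) [:0, 1:])) x * quartic_weight t x \<partial>lborel)"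
proof -
  let ?V = "smult 4 ([:0, 1:] ^ 3) - smult (2 * t) [:0, 1:]"
  let ?f = "\<lambda>x. poly (pderiv q - q * ?V) x * quartic_weight t x"
  have "(LBINT x=-\<infinity>..\<infinity>. ?f x) = 0 - 0"
  proof (rule interval_integral_FTC_integrable)
    show "((\<lambda>x. poly q x * quartic_weight t x) has_vector_derivative ?f x) (at x)" for x
      unfolding quartic_weight_def has_real_derivative_iff_has_vector_derivative[symmetric]
      by (auto intro!: derivative_eq_intros simp: algebra_simps power3_eq_cube power2_eq_square)
    show "isCont ?f x" for x
      unfolding quartic_weight_def by (intro continuous_intros)
    show "set_integrable lborel (einterval (-\<infinity>) \<infinity>) ?f"
      using assms[of "pderiv q - q * ?V"] by (simp add: set_integrable_def)
  qed (simp_all add: ereal_tendsto_simps poly_times_quartic_weight_at_top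
      poly_times_quartic_weight_at_bot)
  then have "(\<integral>x. ?f x \<partial>lborel) = 0"
    by (simp add: interval_lebesgue_integral_def set_lebesgue_integral_def)
  moreover have "(\<integral>x. ?f x \<partial>lborel) = (\<integral>x. poly (pderiv q) x * quartic_weight t x \<partial>lborel) -
      (\<integral>x. poly (q * ?V) x * quartic_weight t x \<partial>lborel)"
    by (simp only: poly_diff left_diff_distrib Bochner_Integration.integral_diff[OF assms assms])
  ultimately show ?thesis by simp
qed

lemma orthogonal_polys_functional:
  fixes P :: "nat \<Rightarrow> real poly" and h :: "nat \<Rightarrow> real"
  assumes deg: "\<And>n. degree (P n) = n" and lead: "\<And>n. lead_coeff (P n) = 1"
    and h: "\<And>n. h n > 0"
    and orth: "\<And>j k. has_bochner_integral lborel
      (\<lambda>x. poly (P j) x * poly (P k) x * quartic_weight t x) (if j = k then h j else 0)"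
  shows "even_quartic_functional (\<lambda>q. \<integral>x. poly q x * quartic_weight t x \<partial>lborel) t P h"
proof -
  have coeff: "coeff (P n) n = 1" for n using lead[of n] by (simp add: deg)
  \<comment> \<open>With \<open>P 0 = 1\<close>, orthogonality against index 0 includes the
    integrability of each single \<open>P n\<close> times the weight.\<close>
  have "P 0 = 1"
    using coeff[of 0] deg[of 0] by (metis degree_0_id of_nat_0 one_pCons)
  then have "integrable lborel (\<lambda>x. poly (P n) x * quartic_weight t x)" for n
    using orth[of n 0] by (simp add: has_bochner_integral_iff)
  then have int: "integrable lborel (\<lambda>x. poly q x * quartic_weight t x)" for q
    by (rule integrable_poly_times[OF deg coeff])
  show ?thesis
  proof
    fix p q :: "real poly" and c :: real and j k n :: nat
    show "(\<integral>x. poly (p + q) x * quartic_weight t x \<partial>lborel) =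
        (\<integral>x. poly p x * quartic_weight t x \<partial>lborel) + (\<integral>x. poly q x * quartic_weight t x \<partial>lborel)"
      using int by (simp add: distrib_right)
    show "(\<integral>x. poly (smult c p) x * quartic_weight t x \<partial>lborel) =
        c * (\<integral>x. poly p x * quartic_weight t x \<partial>lborel)"
      by (simp add: mult.assoc)
    show "(\<integral>x. poly (pcompose p [:0, -1:]) x * quartic_weight t x \<partial>lborel) =
        (\<integral>x. poly p x * quartic_weight t x \<partial>lborel)"
      using lborel_integral_real_affine[of "-1" "\<lambda>x. poly p x * quartic_weight t x" 0]
      by (simp add: poly_pcompose)
    show "(\<integral>x. poly (pderiv p) x * quartic_weight t x \<partial>lborel) =
        (\<integral>x. poly (p * (smult 4 ([:0, 1:] ^ 3) - smult (2 * t) [:0, 1:])) x *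
          quartic_weight t x \<partial>lborel)"
      using int by (rule integral_quartic_weight_by_parts)
    show "degree (P n) = n" "coeff (P n) n = 1" "h n > 0"
      by (rule deg coeff h)+
    show "(\<integral>x. poly (P j * P k) x * quartic_weight t x \<partial>lborel) = (if j = k then h j else 0)"
      using orth[of j k] by (simp add: has_bochner_integral_iff)
  qed
qed

section \<open>Two lemmas on real sequences\<close>

text \<open>
  If \<open>a\<close> and \<open>A\<close> are the lower and upper limits of \<open>x\<close>, the recurrence gives
  \<open>A (A + 2 a) \<le> c \<le> a (a + 2 A)\<close>, hence \<open>A \<le> a\<close>.
\<close>
lemma three_term_product_limit:
  fixes x :: "nat \<Rightarrow> real"
  assumes nonneg: "\<And>n. x n \<ge> 0" and bound: "\<And>n. x n \<le> B" and "c > 0"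
    and lim: "(\<lambda>n. x (Suc n) * (x (Suc (Suc n)) + x (Suc n) + x n)) \<longlonglongrightarrow> c"
  shows "x \<longlonglongrightarrow> sqrt (c / 3)"
proof -
  \<comment> \<open>Eventual upper and lower bounds; their infimum and supremum are the upper and
    lower limits as real numbers.\<close>
  define U where "U = {u. \<forall>\<^sub>F n in sequentially. x n \<le> u}"
  define V where "V = {v. \<forall>\<^sub>F n in sequentially. v \<le> x n}"
  define A where "A = Inf U"
  define a where "a = Sup V"
  have U: "B \<in> U" "\<And>u. u \<in> U \<Longrightarrow> 0 \<le> u"
  proof -
    fix u assume "u \<in> U"
    then obtain n where "x n \<le> u" by (auto simp: U_def eventually_sequentially)
    then show "0 \<le> u" using nonneg[of n] by simp
  qed (simp add: U_def bound)
  have V: "0 \<in> V" "\<And>v. v \<in> V \<Longrightarrow> v \<le> B"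
  proof -
    fix v assume "v \<in> V"
    then obtain n where "v \<le> x n" by (auto simp: V_def eventually_sequentially)
    then show "v \<le> B" using bound[of n] by simp
  qed (simp add: V_def nonneg)
  have upper: "\<forall>\<^sub>F n in sequentially. x n < A + e" if "e > 0" for e
  proof -
    have "Inf U < A + e" using that by (simp add: A_def)
    then obtain u where "u \<in> U" "u < A + e"
      using cInf_lessD[of U "A + e"] U(1) by auto
    then show ?thesis unfolding U_def by (auto elim: eventually_mono)
  qed
  have lower: "\<forall>\<^sub>F n in sequentially. a - e < x n" if "e > 0" for e
  proof -
    have "a - e < Sup V" using that by (simp add: a_def)
    then obtain v where "v \<in> V" "a - e < v"
      using less_cSupD[of V "a - e"] V(1) by auto
    then show ?thesis unfolding V_def by (auto elim: eventually_mono)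
  qed
  have freq_upper: "\<exists>\<^sub>F n in sequentially. A - e < x n" if "e > 0" for e
  proof (rule ccontr)
    assume "\<not> ?thesis"
    then have "A - e \<in> U" by (simp add: U_def frequently_def not_less)
    then show False using that cInf_lower[of "A - e" U] U(2) by (force simp: A_def bdd_below_def)
  qed
  have freq_lower: "\<exists>\<^sub>F n in sequentially. x n < a + e" if "e > 0" for e
  proof (rule ccontr)
    assume "\<not> ?thesis"
    then have "a + e \<in> V" by (simp add: V_def frequently_def not_less)
    then show False using that cSup_upper[of "a + e" V] V(2) by (force simp: a_def bdd_above_def)
  qed
  have a_nonneg: "0 \<le> a"
    unfolding a_def by (rule cSup_upper) (use V in \<open>auto simp: bdd_above_def\<close>)
  let ?y = "\<lambda>n. x (Suc n) * (x (Suc (Suc n)) + x (Suc n) + x n)"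
  have ev: "\<forall>\<^sub>F n in sequentially. c - e < ?y n \<and> ?y n < c + e \<and>
      (\<forall>k \<in> {n, Suc n, Suc (Suc n)}. a - e < x k \<and> x k < A + e)" if "e > 0" for e
  proof -
    have *: "\<forall>\<^sub>F n in sequentially. a - e < x n \<and> x n < A + e"
      using upper[OF that] lower[OF that] by eventually_elim auto
    have **: "\<forall>\<^sub>F n in sequentially. a - e < x (Suc n) \<and> x (Suc n) < A + e"
      using * by (subst eventually_sequentially_Suc)
    have "\<forall>\<^sub>F n in sequentially. a - e < x (Suc (Suc n)) \<and> x (Suc (Suc n)) < A + e"
      using ** by (subst eventually_sequentially_Suc[of "\<lambda>n. a - e < x (Suc n) \<and> x (Suc n) < A + e"])
    moreover have "\<forall>\<^sub>F n in sequentially. c - e < ?y n" "\<forall>\<^sub>F n in sequentially. ?y n < c + e"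
      using order_tendstoD[OF lim] that by auto
    ultimately show ?thesis using * ** by eventually_elim auto
  qed
  have freq_Suc: "\<exists>\<^sub>F n in sequentially. Q (Suc n)" if "\<exists>\<^sub>F n in sequentially. Q n" for Q
    using that unfolding frequently_def by (subst eventually_sequentially_Suc)
  \<comment> \<open>Taken at an index where the middle term is within \<open>e\<close> of the lower
    limit, while both neighbours are below \<open>A + e\<close>.\<close>
  have c_le: "c - e \<le> (a + e) * (a + 2 * A + 3 * e)" if e: "e > 0" for e
  proof -
    obtain n where "x (Suc n) < a + e" "c - e < ?y n"
        "x n < A + e" "x (Suc (Suc n)) < A + e"
      using frequently_eventually_frequently[OF freq_Suc[OF freq_lower[OF e]] ev[OF e]]
      by (auto dest!: frequently_ex)
    moreover have "?y n \<le> (a + e) * (a + 2 * A + 3 * e)"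
      by (rule mult_mono) (use calculation nonneg[of n] nonneg[of "Suc n"] nonneg[of "Suc (Suc n)"]
          a_nonneg e in auto)
    ultimately show ?thesis by linarith
  qed
  have c_le': "c \<le> a * (a + 2 * A)"
  proof (rule tendsto_le)
    show "((\<lambda>e. c - e) \<longlongrightarrow> c) (at_right 0)" by real_asymp
    show "((\<lambda>e. (a + e) * (a + 2 * A + 3 * e)) \<longlongrightarrow> a * (a + 2 * A)) (at_right 0)"
      by (rule tendsto_eq_intros refl | simp)+
    show "\<forall>\<^sub>F e in at_right 0. c - e \<le> (a + e) * (a + 2 * A + 3 * e)"
      using c_le by (auto simp: eventually_at_right_less eventually_at_filter)
  qed simp
  have A_nonneg: "0 \<le> A"
    unfolding A_def by (rule cInf_greatest) (use U in auto)
  have "A \<noteq> 0 \<or> a \<noteq> 0" using c_le' \<open>c > 0\<close> by auto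
  \<comment> \<open>Dually, the middle term is near the upper limit. The bound
    \<open>e < A / 3\<close> keeps the second factor nonnegative, so that the product is
    monotone.\<close>
  have ge_c: "(A - e) * (A + 2 * a - 3 * e) \<le> c + e" if e: "e > 0" "e < A / 3" for e
  proof -
    obtain n where "A - e < x (Suc n)" "?y n < c + e"
        "a - e < x n" "a - e < x (Suc (Suc n))"
      using frequently_eventually_frequently[OF freq_Suc[OF freq_upper[OF e(1)]] ev[OF e(1)]]
      by (auto dest!: frequently_ex)
    moreover have "(A - e) * (A + 2 * a - 3 * e) \<le> ?y n"
      by (rule mult_mono) (use calculation nonneg[of "Suc n"] a_nonneg e in auto)
    ultimately show ?thesis by linarith
  qed
  have "a \<le> A"
  proof (rule field_le_epsilon)
    fix e :: real assume "e > 0"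
    then obtain n where "a - e / 2 < x n" "x n < A + e / 2"
      using ev[of "e / 2"] by (auto simp: eventually_sequentially)
    then show "a \<le> A + e" by linarith
  qed
  have "A > 0"
    using A_nonneg \<open>a \<le> A\<close> a_nonneg \<open>A \<noteq> 0 \<or> a \<noteq> 0\<close> by linarith
  have "A * (A + 2 * a) \<le> c"
  proof (rule tendsto_le)
    show "((\<lambda>e. c + e) \<longlongrightarrow> c) (at_right 0)" by real_asymp
    show "((\<lambda>e. (A - e) * (A + 2 * a - 3 * e)) \<longlongrightarrow> A * (A + 2 * a)) (at_right 0)"
      by (rule tendsto_eq_intros refl | simp)+
    show "\<forall>\<^sub>F e in at_right 0. (A - e) * (A + 2 * a - 3 * e) \<le> c + e"
      unfolding eventually_at_right_field using ge_c \<open>A > 0\<close> by (intro exI[of _ "A / 3"]) auto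
  qed simp
  then have "A\<^sup>2 \<le> a\<^sup>2" using c_le' by (simp add: power2_eq_square algebra_simps)
  then have "A = a" using \<open>a \<le> A\<close> power2_le_imp_le[of A a] a_nonneg by auto
  then have "3 * A\<^sup>2 = c"
    using \<open>A * (A + 2 * a) \<le> c\<close> c_le' by (simp add: power2_eq_square)
  then have "sqrt (c / 3) = A" using A_nonneg real_sqrt_unique by force
  moreover have "x \<longlonglongrightarrow> A"
  proof (rule order_tendstoI)
    fix b assume "b < A"
    then show "\<forall>\<^sub>F n in sequentially. b < x n" using lower[of "A - b"] \<open>A = a\<close> by simp
  next
    fix b assume "A < b"
    then show "\<forall>\<^sub>F n in sequentially. x n < b" using upper[of "b - A"] by simp
  qed
  ultimately show ?thesis by simp
qed

text \<open>
  A discrete maximum principle: \<open>K + \<epsilon> 2\<^sup>n\<close> is a supersolution for every \<open>\<epsilon> > 0\<close>.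
\<close>
lemma bounded_if_subsolution:
  fixes q :: "nat \<Rightarrow> real"
  assumes sub: "\<And>n. n \<ge> N \<Longrightarrow> q (Suc n) \<le> (q (Suc (Suc n)) + q n) / 3 + C"
    and small: "(\<lambda>n. q n / 2 ^ n) \<longlonglongrightarrow> 0"
  shows "\<exists>K. \<forall>n\<ge>N. q n \<le> K"
proof -
  \<comment> \<open>\<open>q N\<close> controls the left end; \<open>3 * C\<close> solves K = 2K/3 +
    C.\<close>
  define K where "K = max (q N) (3 * C)"
  have le: "q n \<le> K + e * 2 ^ n" if "e > 0" "n \<ge> N" for e n
  proof (rule ccontr)
    assume neg: "\<not> ?thesis"
    define d where "d k = q k - (K + e * 2 ^ k)" for k
    have "\<forall>\<^sub>F k in sequentially. q k / 2 ^ k < e / 2"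
      using order_tendstoD(2)[OF small, of "e / 2"] \<open>e > 0\<close> by simp
    moreover have "\<forall>\<^sub>F k in sequentially. - K < e / 2 * 2 ^ k"
      using \<open>e > 0\<close> by real_asymp
    ultimately have "\<forall>\<^sub>F k in sequentially. d k < 0"
      by eventually_elim (auto simp: d_def field_simps)
    then obtain M where M: "\<And>k. k \<ge> M \<Longrightarrow> d k < 0" by (auto simp: eventually_sequentially)
    have "d n > 0" using neg by (simp add: d_def)
    then have "n < M" using M[of n] by (meson not_le order.asym)
    \<comment> \<open>The excess \<open>d\<close> is negative beyond \<open>M\<close>, so its
      maximum over all indices from \<open>N\<close> on is attained in this finite range.\<close>
    define S where "S = d ` {N..M}"
    have "Max S \<in> S"
      by (rule Max_in) (use \<open>n \<ge> N\<close> \<open>n < M\<close> in \<open>auto simp: S_def\<close>)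
    then obtain m where m: "m \<in> {N..M}" "d m = Max S"
      unfolding S_def by force
    have d_le: "d k \<le> d m" if "k \<ge> N" for k
    proof (cases "k \<le> M")
      case True
      then show ?thesis using that m by (simp add: S_def)
    next
      case False
      then have "d k < 0" using M[of k] by simp
      also have "0 < d n" by fact
      also have "d n \<le> d m" using m \<open>n \<ge> N\<close> \<open>n < M\<close> by (simp add: S_def)
      finally show ?thesis by simp
    qed
    have "d m > 0" using d_le[OF \<open>n \<ge> N\<close>] \<open>d n > 0\<close> by simp
    have "q N \<le> K" "e * 2 ^ N > 0" using \<open>e > 0\<close> by (auto simp: K_def)
    then have "d N < 0" by (simp add: d_def)
    then have "m \<noteq> N" using \<open>d m > 0\<close> by auto
    then obtain l where l: "m = Suc l" "l \<ge> N" using m(1) by (cases m) auto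
    \<comment> \<open>Maximality at \<open>Suc l\<close> bounds the sum of the neighbours by 2 q +
      E, so the recurrence forces q \<le> E + 3 C \<le> E + K, whereas a positive excess means q > K
      + 2 E.\<close>
    define E where "E = e * 2 ^ l"
    have "q (Suc l) \<le> (q (Suc (Suc l)) + q l) / 3 + C" using sub l by simp
    moreover have "q (Suc (Suc l)) \<le> q (Suc l) + 2 * E" "q l \<le> q (Suc l) - E" "K + 2 * E < q (Suc l)"
      using d_le[of "Suc (Suc l)"] d_le[of l] l \<open>d m > 0\<close> by (auto simp: d_def E_def)
    moreover have "3 * C \<le> K" "E > 0" using \<open>e > 0\<close> by (auto simp: K_def E_def)
    ultimately show False by (simp add: field_simps)
  qed
  have "q n \<le> K" if "n \<ge> N" for n
  proof (rule field_le_epsilon)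
    fix e :: real assume "e > 0"
    then show "q n \<le> K + e" using le[of "e / 2 ^ n" n] that by simp
  qed
  then show ?thesis by blast
qed

section \<open>The truncated formal solution of the Freud equation\<close>

text \<open>
  With \<open>y = sqrt (n / 3)\<close>, the formal solution of the Freud equation is
  \<open>\<beta>\<^sub>n \<sim> y B (1 / y)\<close> with \<open>B\<close> a power series over \<open>\<rat>[t]\<close>. The polynomial for \<open>s = 0\<close> is \<open>B\<close>
  modulo \<open>z\<^sup>8\<close>; for \<open>s = 1\<close> and \<open>s = -1\<close> it is the expansion of \<open>\<beta>\<^sub>n\<^sub>+\<^sub>s\<close> re-expressed in the \<open>y\<close>
  belonging to \<open>n\<close>.
\<close>
definition freud_series :: "real \<Rightarrow> real \<Rightarrow> real poly" where
  "freud_series t s =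
    [:1/2, t/12, s/12 + t^2/144, 0,
      - (s^2)/144 - s*t^2/864 + (1/432 - t^4/20736), t/2592,
      s^3/864 + s^2*t^2/3456 - s/2 * (1/432 - t^4/20736) + t^6/1492992 - t^2/10368,
      - (s*t)/3888 - t^3/46656:]"

definition freud_approx :: "real \<Rightarrow> real \<Rightarrow> real \<Rightarrow> real" where
  "freud_approx t s y = y * poly (freud_series t s) (1 / y)"

section \<open>Re-expansion at shifted arguments\<close>

text \<open>As y^2 = n/3, \<open>w y\<close> is the y belonging to n + s. The powers listed are the
  nonconstant ones occurring in \<open>freud_approx t 0\<close>, where y^(-2) has coefficient
  0.\<close>

lemma root_expansions:
  fixes s :: real
  assumes s: "s = 1 \<or> s = -1"
  defines "w \<equiv> \<lambda>y::real. sqrt (y^2 + s/3)"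
  shows "(\<lambda>y. w y - (y + s/6 / y - s^2/72 / y ^ 3 + s^3/432 / y ^ 5)) \<in> O(\<lambda>y. y powr (-7))"
    and "(\<lambda>y. 1 / w y - (1 / y - s/6 / y ^ 3 + s^2/24 / y ^ 5)) \<in> O(\<lambda>y. y powr (-7))"
    and "(\<lambda>y. 1 / w y ^ 3 - (1 / y ^ 3 - s/2 / y ^ 5)) \<in> O(\<lambda>y. y powr (-7))"
    and "(\<lambda>y. 1 / w y ^ 4 - (1 / y ^ 4 - 2 * s/3 / y ^ 6)) \<in> O(\<lambda>y. y powr (-7))"
    and "(\<lambda>y. 1 / w y ^ 5 - 1 / y ^ 5) \<in> O(\<lambda>y. y powr (-7))"
    and "(\<lambda>y. 1 / w y ^ 6 - 1 / y ^ 6) \<in> O(\<lambda>y. y powr (-7))"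
  unfolding w_def by - (rule disjE[OF assms(1)]; hypsubst; real_asymp)+

lemma cmult_bigo: "f \<in> O[F](g) \<Longrightarrow> (\<lambda>x. c * f x) \<in> O[F](g)" for c :: real
  by (cases "c = 0") auto

lemma freud_approx_shift:
  assumes "s = 1 \<or> s = -1"
  shows "(\<lambda>y. freud_approx t 0 (sqrt (y^2 + s/3)) - freud_approx t s y) \<in> O(\<lambda>y. y powr (-7))"
proof -
  define w where "w y = sqrt (y^2 + s/3)" for y
  \<comment> \<open>The weights are the coefficients of \<open>freud_series t 0\<close>; the
    constant term t/12 cancels in the difference.\<close>
  let ?f = "\<lambda>y. 1/2 * (w y - (y + s/6 / y - s^2/72 / y ^ 3 + s^3/432 / y ^ 5))
      + t^2/144 * (1 / w y - (1 / y - s/6 / y ^ 3 + s^2/24 / y ^ 5))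
      + (1/432 - t^4/20736) * (1 / w y ^ 3 - (1 / y ^ 3 - s/2 / y ^ 5))
      + t/2592 * (1 / w y ^ 4 - (1 / y ^ 4 - 2 * s/3 / y ^ 6))
      + (t^6/1492992 - t^2/10368) * (1 / w y ^ 5 - 1 / y ^ 5)
      - t^3/46656 * (1 / w y ^ 6 - 1 / y ^ 6)"
  have "?f \<in> O(\<lambda>y. y powr (-7))"
    unfolding w_def by (intro sum_in_bigo cmult_bigo root_expansions assms)
  also have "?this \<longleftrightarrow> ?thesis"
  proof (rule landau_o.big.in_cong)
    have "\<forall>\<^sub>F y in at_top. w y > 0" unfolding w_def by real_asymp
    moreover have "\<forall>\<^sub>F y::real in at_top. y > 0" by (rule eventually_gt_at_top)
    ultimately show "\<forall>\<^sub>F y in at_top. ?f y = freud_approx t 0 (sqrt (y^2 + s/3)) - freud_approx t s y"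
    proof eventually_elim
      case (elim y)
      have 0: "freud_approx t 0 u = u/2 + t/12 + t^2/144 / u + (1/432 - t^4/20736) / u^3
          + t/2592 / u^4 + (t^6/1492992 - t^2/10368) / u^5 - t^3/46656 / u^6" if "u > 0" for u
        using that by (simp add: freud_approx_def freud_series_def divide_simps eval_nat_numeral)
          (simp add: algebra_simps)
      have s: "freud_approx t s y = y/2 + t/12 + (s/12 + t^2/144) / y
          + (- (s^2)/144 - s*t^2/864 + (1/432 - t^4/20736)) / y^3 + t/2592 / y^4
          + (s^3/864 + s^2*t^2/3456 - s/2 * (1/432 - t^4/20736) + t^6/1492992 - t^2/10368) / y^5
          - (s*t/3888 + t^3/46656) / y^6"
        using elim by (simp add: freud_approx_def freud_series_def divide_simps eval_nat_numeral)
          (simp add: algebra_simps)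
      show ?case unfolding w_def[symmetric] 0[OF elim(1)] s
        by (simp add: algebra_simps diff_divide_distrib add_divide_distrib)
    qed
  qed
  finally show ?thesis .
qed

lemma poly_inverse_bigo: "(\<lambda>y. poly r (1 / y)) \<in> O[at_top](\<lambda>_. 1 :: real)"
proof (rule bigoI_tendsto)
  have "((\<lambda>y::real. 1 / y) \<longlongrightarrow> 0) at_top" by real_asymp
  then show "((\<lambda>y. poly r (1 / y) / 1) \<longlongrightarrow> poly r 0) at_top"
    by (auto intro: tendsto_poly)
qed auto

lemma freud_approx_bigo: "freud_approx t s \<in> O(\<lambda>y. y powr 1)"
proof -
  have "(\<lambda>y. y * poly (freud_series t s) (1 / y)) \<in> O(\<lambda>y. y * 1)"
    by (intro landau_o.big.mult poly_inverse_bigo) auto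
  also have "(\<lambda>y::real. y * 1) \<in> O(\<lambda>y. y powr 1)" by real_asymp
  finally show ?thesis by (simp add: freud_approx_def[abs_def])
qed

lemma freud_approx_asymp: "((\<lambda>y. freud_approx t s y / y) \<longlongrightarrow> 1/2) at_top"
proof -
  have "((\<lambda>y::real. 1 / y) \<longlongrightarrow> 0) at_top" by real_asymp
  then have "((\<lambda>y. poly (freud_series t s) (1 / y)) \<longlongrightarrow> poly (freud_series t s) 0) at_top"
    by (rule tendsto_poly)
  also have "poly (freud_series t s) 0 = 1/2" by (simp add: freud_series_def)
  finally show ?thesis
  proof (rule Lim_transform_eventually)
    show "\<forall>\<^sub>F y in at_top. poly (freud_series t s) (1 / y) = freud_approx t s y / y"
      using eventually_gt_at_top[of "0::real"] by eventually_elim (simp add: freud_approx_def)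
  qed
qed

section \<open>Formal identities modulo z^8 and their residuals\<close>

text \<open>The Freud equation with n = 3 y^2, divided by y^2 and written in z = 1/y. Divisibility
  by z^8 reduces to eight coefficient identities.\<close>

lemma freud_series_string:
  "monom 1 8 dvd smult 4 (freud_series t 0) *
     (freud_series t 1 + freud_series t 0 + freud_series t (-1)) -
     smult (2 * t) (pCons 0 (freud_series t 0)) - [:3:]"
  unfolding monom_1_dvd_iff' freud_series_def
  by (auto simp: less_Suc_eq eval_nat_numeral coeff_mult)
    (simp_all add: add_divide_distrib diff_divide_distrib ring_distribs ac_simps)

text \<open>The closed form for p(n,t), divided by y^3: here (n - 1)/2 becomes 3/2 - z^2/2, and the
  explicit polynomial holds the claimed expansion in powers of z.\<close>

lemma freud_series_subleading:
  "monom 1 8 dvd - freud_series t 0 * ([:3/2, 0, -1/2:] + smult 2 (freud_series t 1) * freud_series t (-1)) -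
     [:- 1, - t/4, - (t^2 - 6)/24, - t*(t^2-9)/216, - (t^4 - 12*t^2 - 24)/3456, t/864,
       (t^6 - 18*t^4 - 72*t^2 + 864)/746496, - t*(t^2-6)/31104:]"
  unfolding monom_1_dvd_iff' freud_series_def
  by (auto simp: less_Suc_eq eval_nat_numeral coeff_mult)
    (simp_all add: add_divide_distrib diff_divide_distrib ring_distribs ac_simps)

text \<open>Restoring the factor y^2 turns the remainder z^8 into y^(-6).\<close>

lemma freud_approx_residual:
  "(\<lambda>y. 4 * freud_approx t 0 y * (freud_approx t 1 y + freud_approx t 0 y + freud_approx t (-1) y) -
      2 * t * freud_approx t 0 y - 3 * y^2) \<in> O(\<lambda>y. y powr (-6))"
proof -
  obtain r where r: "smult 4 (freud_series t 0) *
      (freud_series t 1 + freud_series t 0 + freud_series t (-1)) -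
      smult (2 * t) (pCons 0 (freud_series t 0)) - [:3:] = monom 1 8 * r"
    using freud_series_string[of t] by (auto elim: dvdE)
  have "(\<lambda>y::real. y powr (-6) * poly r (1 / y)) \<in> O(\<lambda>y. y powr (-6) * 1)"
    by (intro landau_o.big.mult poly_inverse_bigo) auto
  moreover have "\<forall>\<^sub>F y in at_top. y powr (-6) * poly r (1 / y) =
      4 * freud_approx t 0 y * (freud_approx t 1 y + freud_approx t 0 y + freud_approx t (-1) y) -
      2 * t * freud_approx t 0 y - 3 * y^2"
    using eventually_gt_at_top[of "0::real"]
  proof eventually_elim
    case (elim y)
    have "y powr (-6) * poly r (1 / y) = y^2 * poly (monom 1 8 * r) (1 / y)"
      using elim by (simp add: poly_monom powr_minus powr_numeral field_simps eval_nat_numeral)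
    also have "\<dots> = 4 * freud_approx t 0 y *
        (freud_approx t 1 y + freud_approx t 0 y + freud_approx t (-1) y) -
        2 * t * freud_approx t 0 y - 3 * y^2"
      unfolding r[symmetric] using elim by (simp add: freud_approx_def field_simps power2_eq_square)
    finally show ?case .
  qed
  ultimately show ?thesis
    by (subst landau_o.big.in_cong[symmetric]) simp_all
qed

text \<open>Restoring the factor y^3 turns the remainder z^8 into y^(-5), the order n^(-5/2) of the
  final error.\<close>

lemma freud_approx_subleading:
  "(\<lambda>y. - freud_approx t 0 y * ((3 * y^2 - 1) / 2 + 2 * freud_approx t 1 y * freud_approx t (-1) y) -
      (- (y^3) - t * y^2 / 4 - (t^2 - 6) * y / 24 - t * (t^2 - 9) / 216 -
        (t^4 - 12 * t^2 - 24) / (3456 * y) + t / (864 * y^2) +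
        (t^6 - 18 * t^4 - 72 * t^2 + 864) / (746496 * y^3) -
        t * (t^2 - 6) / (31104 * y^4))) \<in> O(\<lambda>y. y powr (-5))"
  (is "?f \<in> _")
proof -
  obtain r where r: "- freud_series t 0 *
     ([:3/2, 0, -1/2:] + smult 2 (freud_series t 1) * freud_series t (-1)) -
     [:- 1, - t/4, - (t^2 - 6)/24, - t*(t^2-9)/216, - (t^4 - 12*t^2 - 24)/3456, t/864,
       (t^6 - 18*t^4 - 72*t^2 + 864)/746496, - t*(t^2-6)/31104:] = monom 1 8 * r"
    (is "?A - ?B = _")
    using freud_series_subleading[of t] by (auto elim: dvdE)
  have "(\<lambda>y::real. y powr (-5) * poly r (1 / y)) \<in> O(\<lambda>y. y powr (-5) * 1)"
    by (intro landau_o.big.mult poly_inverse_bigo) auto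
  moreover have "\<forall>\<^sub>F y in at_top. y powr (-5) * poly r (1 / y) = ?f y"
    using eventually_gt_at_top[of "0::real"]
  proof eventually_elim
    case (elim y)
    have "y powr (-5) * poly r (1 / y) = y^3 * poly (monom 1 8 * r) (1 / y)"
      using elim by (simp add: poly_monom powr_minus powr_numeral field_simps eval_nat_numeral)
    also have "\<dots> = y^3 * poly ?A (1 / y) - y^3 * poly ?B (1 / y)"
      unfolding r[symmetric] by (simp add: algebra_simps)
    also have "y^3 * poly ?A (1 / y) =
        - freud_approx t 0 y * ((3 * y^2 - 1) / 2 + 2 * freud_approx t 1 y * freud_approx t (-1) y)"
      using elim by (simp add: freud_approx_def field_simps power2_eq_square power3_eq_cube)
    also have "y^3 * poly ?B (1 / y) = (- (y^3) - t * y^2 / 4 - (t^2 - 6) * y / 24 - t * (t^2 - 9) / 216 -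
        (t^4 - 12 * t^2 - 24) / (3456 * y) + t / (864 * y^2) +
        (t^6 - 18 * t^4 - 72 * t^2 + 864) / (746496 * y^3) -
        t * (t^2 - 6) / (31104 * y^4))"
    proof -
      have "y^3 * poly [:c0, c1, c2, c3, c4, c5, c6, c7:] (1 / y) =
          c0 * y^3 + c1 * y^2 + c2 * y + c3 + c4 / y + c5 / y^2 + c6 / y^3 + c7 / y^4"
        for c0 c1 c2 c3 c4 c5 c6 c7 :: real
        using elim by (simp add: field_simps eval_nat_numeral)
      then show ?thesis by (simp only:)
    qed
    finally show ?case .
  qed
  ultimately show ?thesis
    by (subst landau_o.big.in_cong[symmetric]) simp_all
qed

section \<open>Asymptotics of the recurrence coefficients\<close>

text \<open>The recurrence is assumed only around indices from 2 on, because
  \<open>\<beta> 0\<close> does not have its conventional value 0.\<close>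

locale freud_recurrence =
  fixes \<beta> :: "nat \<Rightarrow> real" and t :: real
  assumes pos: "\<beta> n > 0"
    and recurrence: "n \<ge> 1 \<Longrightarrow>
      4 * \<beta> (Suc n) * (\<beta> (Suc (Suc n)) + \<beta> (Suc n) + \<beta> n) - 2 * t * \<beta> (Suc n) = real (Suc n)"
begin

definition Y :: "nat \<Rightarrow> real" where "Y n = sqrt (real n / 3)"

lemma Y_pos: "n > 0 \<Longrightarrow> Y n > 0"
  by (simp add: Y_def)

lemma Y_square: "3 * (Y n)^2 = real n"
  by (simp add: Y_def)

lemma Y_Suc_Suc: "Y (Suc (Suc n)) = sqrt ((Y (Suc n))^2 + 1/3)"
  by (simp add: Y_def field_simps)

lemma Y_pred: "Y n = sqrt ((Y (Suc n))^2 + (-1)/3)"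
  by (simp add: Y_def field_simps)

lemma Y_powr: "Y n powr p = (real n / 3) powr (p / 2)"
  by (simp add: Y_def powr_half_sqrt[symmetric] powr_powr)

lemma Y_at_top: "filterlim Y at_top sequentially"
  unfolding Y_def by real_asymp

lemma Y_Suc_at_top: "filterlim (\<lambda>n. Y (Suc n)) at_top sequentially"
  using Y_at_top by (rule filterlim_compose) (rule filterlim_Suc)

text \<open>Dropping the positive cross terms leaves 4 \<beta>^2 - 2t \<beta> < n, which fails once
  \<beta> exceeds |t| + sqrt n.\<close>

lemma \<beta>_bounded: "\<exists>B. \<forall>n. \<beta> n / Y n \<le> B"
proof -
  have le: "\<beta> (Suc n) / Y (Suc n) \<le> sqrt 3 * (\<bar>t\<bar> + 1)" if "n \<ge> 1" for n
  proof -
    let ?b = "\<beta> (Suc n)"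
    have "?b \<le> \<bar>t\<bar> + sqrt (Suc n)"
    proof (rule ccontr)
      assume neg: "\<not> ?thesis"
      have "(sqrt (Suc n))^2 < ?b^2"
        by (rule power_strict_mono) (use neg in auto)
      moreover have "t * ?b \<le> ?b^2"
        unfolding power2_eq_square
      proof (rule mult_right_mono)
        have "sqrt (Suc n) \<ge> 0" by simp
        then show "t \<le> ?b" using neg by linarith
      qed (use pos[of "Suc n"] in simp)
      moreover have "0 < ?b * (\<beta> (Suc (Suc n)) + \<beta> n)"
        using pos by (simp add: add_pos_pos)
      ultimately show False
        using recurrence[OF that] by (simp add: algebra_simps power2_eq_square)
    qed
    also have "\<dots> \<le> (\<bar>t\<bar> + 1) * sqrt (Suc n)"
      by (simp add: algebra_simps mult_le_cancel_left1)
    finally have "?b / sqrt (Suc n) \<le> \<bar>t\<bar> + 1" by (simp add: pos_divide_le_eq)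
    then have "sqrt 3 * (?b / sqrt (Suc n)) \<le> sqrt 3 * (\<bar>t\<bar> + 1)" by (rule mult_left_mono) simp
    then show ?thesis by (simp add: Y_def real_sqrt_divide mult.commute)
  qed
  \<comment> \<open>Index 1 is out of reach of the recurrence; at index 0 the quotient is 0 because
    \<open>Y 0 = 0\<close>.\<close>
  have "\<beta> n / Y n \<le> max (\<beta> 1 / Y 1) (sqrt 3 * (\<bar>t\<bar> + 1))" for n
  proof (cases n)
    case 0
    then show ?thesis by (simp add: Y_def le_max_iff_disj)
  next
    case (Suc m)
    then show ?thesis using le[of m] by (cases "m = 0") (auto simp: le_max_iff_disj)
  qed
  then show ?thesis by blast
qed

text \<open>Dividing the recurrence by 4 Y^2 gives the hypothesis of
  \<open>three_term_product_limit\<close> with limit 3/4. In \<open>?bd\<close>, boundedness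
  controls the cost of replacing ratios of neighbouring \<open>Y\<close> by 1 and of dropping the
  linear term.\<close>

lemma \<beta>_asymp: "(\<lambda>n. \<beta> n / Y n) \<longlonglongrightarrow> 1/2"
proof -
  define x where "x n = \<beta> n / Y n" for n
  obtain B where B: "\<And>n. x n \<le> B" using \<beta>_bounded by (auto simp: x_def)
  have nonneg: "x n \<ge> 0" for n using pos[of n] by (simp add: x_def Y_def)
  have "B \<ge> 0" using B[of 0] nonneg[of 0] by linarith
  let ?y = "\<lambda>n. x (Suc n) * (x (Suc (Suc n)) + x (Suc n) + x n)"
  let ?bd = "\<lambda>n. B * B * \<bar>1 - Y (Suc (Suc n)) / Y (Suc n)\<bar> +
    B * B * \<bar>1 - Y n / Y (Suc n)\<bar> + B * \<bar>t / (2 * Y (Suc n))\<bar>"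
  have lim: "?y \<longlonglongrightarrow> 3/4"
  proof (rule LIM_zero_cancel, rule Lim_null_comparison)
    show "\<forall>\<^sub>F n in sequentially. norm (?y n - 3/4) \<le> ?bd n"
      using eventually_ge_at_top[of 1]
    proof eventually_elim
      case (elim n)
      have Y: "Y n > 0" "Y (Suc n) > 0" "Y (Suc (Suc n)) > 0" using elim by (auto simp: Y_pos)
      have "x (Suc n) * (x (Suc (Suc n)) * (Y (Suc (Suc n)) / Y (Suc n)) + x (Suc n) +
          x n * (Y n / Y (Suc n))) = \<beta> (Suc n) * (\<beta> (Suc (Suc n)) + \<beta> (Suc n) + \<beta> n) / (Y (Suc n))^2"
        using Y by (simp add: x_def field_simps power2_eq_square)
      also have "\<beta> (Suc n) * (\<beta> (Suc (Suc n)) + \<beta> (Suc n) + \<beta> n) =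
          (3 * (Y (Suc n))^2 + 2 * t * \<beta> (Suc n)) / 4"
        using recurrence[OF elim] unfolding Y_square by simp
      also have "(3 * (Y (Suc n))^2 + 2 * t * \<beta> (Suc n)) / 4 / (Y (Suc n))^2 =
          3/4 + x (Suc n) * (t / (2 * Y (Suc n)))"
        using Y by (simp add: x_def field_simps power2_eq_square)
      finally have "?y n - 3/4 = x (Suc n) * x (Suc (Suc n)) * (1 - Y (Suc (Suc n)) / Y (Suc n)) +
          x (Suc n) * x n * (1 - Y n / Y (Suc n)) + x (Suc n) * (t / (2 * Y (Suc n)))"
        by (simp add: algebra_simps)
      also have "norm \<dots> \<le> \<bar>x (Suc n) * x (Suc (Suc n)) * (1 - Y (Suc (Suc n)) / Y (Suc n))\<bar> +
          \<bar>x (Suc n) * x n * (1 - Y n / Y (Suc n))\<bar> + \<bar>x (Suc n) * (t / (2 * Y (Suc n)))\<bar>"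
        unfolding real_norm_def by linarith
      also have "\<dots> \<le> ?bd n"
        unfolding abs_mult abs_of_nonneg[OF nonneg]
        by (intro add_mono mult_mono mult_right_mono B nonneg \<open>B \<ge> 0\<close> mult_nonneg_nonneg) auto
      finally show ?case .
    qed
    have "(\<lambda>n. \<bar>1 - Y (Suc (Suc n)) / Y (Suc n)\<bar>) \<longlonglongrightarrow> 0" "(\<lambda>n. \<bar>1 - Y n / Y (Suc n)\<bar>) \<longlonglongrightarrow> 0"
      unfolding Y_def by real_asymp+
    moreover have "(\<lambda>n. \<bar>t / (2 * Y (Suc n))\<bar>) \<longlonglongrightarrow> 0"
    proof -
      have "(\<lambda>n. t / 2 * (1 / Y (Suc n))) \<longlonglongrightarrow> t / 2 * 0"
        unfolding Y_def by (intro tendsto_mult tendsto_const) real_asymp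
      then show ?thesis by (intro tendsto_rabs_zero) simp
    qed
    ultimately show "?bd \<longlonglongrightarrow> 0"
      by (intro tendsto_add_zero tendsto_mult_right_zero)
  qed
  have "x \<longlonglongrightarrow> sqrt (3/4 / 3)"
    by (rule three_term_product_limit[OF nonneg B _ lim]) simp
  also have "sqrt (3/4 / 3) = 1/2" by (rule real_sqrt_unique) (auto simp: power2_eq_square)
  finally show ?thesis by (simp add: x_def[abs_def])
qed

section \<open>Comparison with the truncated solution\<close>

definition b :: "nat \<Rightarrow> real" where "b n = freud_approx t 0 (Y n)"

lemma b_asymp: "(\<lambda>n. b n / Y n) \<longlonglongrightarrow> 1/2"
  unfolding b_def by (rule filterlim_compose[OF freud_approx_asymp Y_at_top])

lemma b_Suc_Suc:
  "(\<lambda>n. b (Suc (Suc n)) - freud_approx t 1 (Y (Suc n))) \<in> O(\<lambda>n. Y (Suc n) powr (-7))"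
  using landau_o.big.compose[OF freud_approx_shift[of 1 t] Y_Suc_at_top]
  by (simp add: b_def Y_Suc_Suc)

lemma b_pred:
  "(\<lambda>n. b n - freud_approx t (-1) (Y (Suc n))) \<in> O(\<lambda>n. Y (Suc n) powr (-7))"
proof -
  have "b n = freud_approx t 0 (sqrt ((Y (Suc n))^2 + (-1)/3))" for n
    by (simp only: b_def Y_pred[of n])
  then show ?thesis
    using landau_o.big.compose[OF freud_approx_shift[of "-1" t] Y_Suc_at_top] by (simp only: simp_thms)
qed

lemma freud_approx_Y_bigo: "(\<lambda>n. freud_approx t s (Y (Suc n))) \<in> O(\<lambda>n. Y (Suc n) powr 1)"
  by (rule landau_o.big.compose[OF freud_approx_bigo Y_Suc_at_top])

lemma Y_powr_bigo: "p \<le> q \<Longrightarrow> (\<lambda>n. Y (Suc n) powr p) \<in> O(\<lambda>n. Y (Suc n) powr q)"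
proof (rule landau_o.big.compose[OF _ Y_Suc_at_top])
  assume "p \<le> q"
  then show "(\<lambda>y. y powr p) \<in> O(\<lambda>y. y powr q)"
    by (intro bigoI[of _ 1] eventually_mono[OF eventually_ge_at_top[of 1]]) (auto intro: powr_mono)
qed

text \<open>Replacing both neighbours by their re-expansions costs Y^(-7), multiplied by a factor of
  size Y; this matches the residual order Y^(-6).\<close>

lemma b_residual:
  "(\<lambda>n. 4 * b (Suc n) * (b (Suc (Suc n)) + b (Suc n) + b n) - 2 * t * b (Suc n) - real (Suc n))
     \<in> O(\<lambda>n. Y (Suc n) powr (-6))"
proof -
  let ?a = "\<lambda>s n. freud_approx t s (Y (Suc n))"
  have 1: "(\<lambda>n. 4 * ?a 0 n * (?a 1 n + ?a 0 n + ?a (-1) n) - 2 * t * ?a 0 n - 3 * (Y (Suc n))^2)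
      \<in> O(\<lambda>n. Y (Suc n) powr (-6))"
    by (rule landau_o.big.compose[OF freud_approx_residual Y_Suc_at_top])
  have "(\<lambda>n. 4 * (?a 0 n * ((b (Suc (Suc n)) - ?a 1 n) + (b n - ?a (-1) n))))
      \<in> O(\<lambda>n. Y (Suc n) powr 1 * Y (Suc n) powr (-7))"
    by (intro cmult_bigo landau_o.big.mult sum_in_bigo freud_approx_Y_bigo b_Suc_Suc b_pred)
  then have 2: "(\<lambda>n. 4 * (?a 0 n * ((b (Suc (Suc n)) - ?a 1 n) + (b n - ?a (-1) n))))
      \<in> O(\<lambda>n. Y (Suc n) powr (-6))"
    unfolding powr_add[symmetric] by simp
  have split: "4 * x * (u + x + v) - 2 * t * x - m =
      (4 * x * (u' + x + v') - 2 * t * x - m) + 4 * (x * ((u - u') + (v - v')))"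
    for x u v u' v' m :: real
    by (simp add: algebra_simps)
  have "4 * b (Suc n) * (b (Suc (Suc n)) + b (Suc n) + b n) - 2 * t * b (Suc n) - real (Suc n) =
      (4 * ?a 0 n * (?a 1 n + ?a 0 n + ?a (-1) n) - 2 * t * ?a 0 n - 3 * (Y (Suc n))^2) +
      4 * (?a 0 n * ((b (Suc (Suc n)) - ?a 1 n) + (b n - ?a (-1) n)))" for n
    unfolding Y_square b_def by (rule split)
  then show ?thesis
    using sum_in_bigo(1)[OF 1 2] by (simp only:)
qed

lemma \<beta>_minus_b: "(\<lambda>n. \<beta> n - b n) \<in> O(\<lambda>n. Y n powr (-7))"
proof -
  define e where "e n = \<beta> n - b n" for n
  define q where "q n = \<bar>e n\<bar> * Y n ^ 7" for n
  \<comment> \<open>The coefficient of \<open>e (Suc n)\<close> once the equations for \<beta> and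
    \<open>b\<close> are subtracted; it grows like 8 Y, since 4 (1/2) + 4 (3/2) = 8.\<close>
  define D where "D n = 4 * \<beta> (Suc n) + 4 * (b (Suc (Suc n)) + b (Suc n) + b n) - 2 * t" for n
  define res where "res n = 4 * b (Suc n) * (b (Suc (Suc n)) + b (Suc n) + b n) -
    2 * t * b (Suc n) - real (Suc n)" for n
  \<comment> \<open>The coupling to the neighbours, which tends to 1/4, corrected for moving the
    weight Y^7 from index \<open>n\<close> to \<open>Suc n\<close>.\<close>
  define \<kappa> where "\<kappa> n = 4 * \<beta> (Suc n) / D n * (Y (Suc n) / Y n) ^ 7" for n
  have Suc_lim: "(\<lambda>n. \<beta> (Suc n) / Y (Suc n)) \<longlonglongrightarrow> 1/2" "(\<lambda>n. b (Suc n) / Y (Suc n)) \<longlonglongrightarrow> 1/2"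
    by (rule LIMSEQ_Suc[OF \<beta>_asymp], rule LIMSEQ_Suc[OF b_asymp])
  have ratio: "(\<lambda>n. Y (Suc (Suc n)) / Y (Suc n)) \<longlonglongrightarrow> 1" "(\<lambda>n. Y n / Y (Suc n)) \<longlonglongrightarrow> 1"
      "(\<lambda>n. Y (Suc n) / Y n) \<longlonglongrightarrow> 1" "(\<lambda>n. 1 / Y (Suc n)) \<longlonglongrightarrow> 0"
    unfolding Y_def by real_asymp+
  have D_lim: "(\<lambda>n. D n / Y (Suc n)) \<longlonglongrightarrow> 8"
  proof (rule Lim_transform_eventually)
    show "(\<lambda>n. 4 * (\<beta> (Suc n) / Y (Suc n)) + 4 * (b (Suc (Suc n)) / Y (Suc (Suc n)) * (Y (Suc (Suc n)) / Y (Suc n)) +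
        b (Suc n) / Y (Suc n) + b n / Y n * (Y n / Y (Suc n))) - 2 * t * (1 / Y (Suc n))) \<longlonglongrightarrow> 8"
      by (rule tendsto_eq_intros Suc_lim b_asymp ratio LIMSEQ_Suc[OF Suc_lim(2)] refl | simp)+
    show "\<forall>\<^sub>F n in sequentially. 4 * (\<beta> (Suc n) / Y (Suc n)) + 4 * (b (Suc (Suc n)) / Y (Suc (Suc n)) * (Y (Suc (Suc n)) / Y (Suc n)) +
        b (Suc n) / Y (Suc n) + b n / Y n * (Y n / Y (Suc n))) - 2 * t * (1 / Y (Suc n)) = D n / Y (Suc n)"
      using eventually_gt_at_top[of 0]
    proof eventually_elim
      case (elim n)
      then have "Y n > 0" "Y (Suc n) > 0" "Y (Suc (Suc n)) > 0" by (auto simp: Y_pos)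
      then show ?case by (simp add: D_def field_simps)
    qed
  qed
  have D_inv_lim: "(\<lambda>n. Y (Suc n) / D n) \<longlonglongrightarrow> 1/8"
    using tendsto_inverse[OF D_lim] by (simp add: inverse_eq_divide)
  have "(\<lambda>n. 4 * (\<beta> (Suc n) / Y (Suc n)) * (Y (Suc n) / D n) * (Y (Suc n) / Y n) ^ 7) \<longlonglongrightarrow> 4 * (1/2) * (1/8) * 1 ^ 7"
    by (intro tendsto_intros Suc_lim D_inv_lim ratio)
  moreover have "4 * (\<beta> (Suc n) / Y (Suc n)) * (Y (Suc n) / D n) = 4 * \<beta> (Suc n) / D n" for n
    using Y_pos[of "Suc n"] by simp
  ultimately have "\<kappa> \<longlonglongrightarrow> 4 * (1/2) * (1/8) * 1 ^ 7" by (simp only: \<kappa>_def[abs_def])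
  then have "\<kappa> \<longlonglongrightarrow> 1/4" by simp
  then have ev_\<kappa>: "\<forall>\<^sub>F n in sequentially. \<kappa> n < 1/3"
    by (rule order_tendstoD) simp
  have ev_D: "\<forall>\<^sub>F n in sequentially. D n > 0"
  proof -
    have "\<forall>\<^sub>F n in sequentially. D n / Y (Suc n) > 0"
      using D_lim by (rule order_tendstoD) simp
    then show ?thesis
    proof eventually_elim
      case (elim n)
      then show ?case using Y_pos[of "Suc n"] by (simp add: zero_less_divide_iff)
    qed
  qed
  have p6: "Y (Suc n) ^ 6 = Y (Suc n) powr 6" for n
    using Y_pos[of "Suc n"] by (subst powr_numeral) auto
  have "(\<lambda>n. res n * Y (Suc n) ^ 6 * (Y (Suc n) / D n)) \<in> O(\<lambda>n. Y (Suc n) powr (-6) * Y (Suc n) powr 6 * 1)"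
  proof (intro landau_o.big.mult)
    show "res \<in> O(\<lambda>n. Y (Suc n) powr (-6))" unfolding res_def by (rule b_residual)
    show "(\<lambda>n. Y (Suc n) ^ 6) \<in> O(\<lambda>n. Y (Suc n) powr 6)" unfolding p6 by (rule landau_o.big_refl)
    show "(\<lambda>n. Y (Suc n) / D n) \<in> O(\<lambda>_. 1)"
      by (rule bigoI_tendsto[of _ _ "1/8"]) (use D_inv_lim in auto)
  qed
  moreover have "Y (Suc n) powr (-6) * Y (Suc n) powr 6 * 1 = 1" for n
    unfolding powr_add[symmetric] using Y_pos[of "Suc n"] by simp
  ultimately have "(\<lambda>n. res n * Y (Suc n) ^ 6 * (Y (Suc n) / D n)) \<in> O(\<lambda>_. 1)"
    by (simp only:)
  then obtain C where "\<forall>\<^sub>F n in sequentially.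
      norm (res n * Y (Suc n) ^ 6 * (Y (Suc n) / D n)) \<le> C * norm (1 :: real)"
    by (rule landau_o.bigE)
  then have C: "\<forall>\<^sub>F n in sequentially. \<bar>res n * Y (Suc n) ^ 6 * (Y (Suc n) / D n)\<bar> \<le> C"
    by (simp only: real_norm_def abs_one mult_1_right)
  have sub: "\<forall>\<^sub>F n in sequentially. q (Suc n) \<le> (q (Suc (Suc n)) + q n) / 3 + C"
    using C ev_D ev_\<kappa> eventually_ge_at_top[of 1]
  proof eventually_elim
    case (elim n)
    have Y: "Y n > 0" "Y (Suc n) > 0" "Y (Suc (Suc n)) > 0" using elim by (auto simp: Y_pos)
    have Y_le: "Y n \<le> Y (Suc n)" "Y (Suc n) \<le> Y (Suc (Suc n))" by (simp_all add: Y_def)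
    let ?\<rho> = "4 * \<beta> (Suc n) / D n"
    have \<rho>: "?\<rho> \<ge> 0" using pos[of "Suc n"] elim by simp
    have "e (Suc n) * D n = - 4 * \<beta> (Suc n) * (e (Suc (Suc n)) + e n) - res n"
      using recurrence[of n] elim by (simp add: e_def D_def res_def algebra_simps)
    then have "e (Suc n) = (- 4 * \<beta> (Suc n) * (e (Suc (Suc n)) + e n) - res n) / D n"
      using elim by (simp add: eq_divide_eq)
    also have "\<dots> = - (?\<rho> * (e (Suc (Suc n)) + e n)) - res n / D n"
      by (simp add: diff_divide_distrib)
    also have "\<bar>\<dots>\<bar> \<le> \<bar>?\<rho> * (e (Suc (Suc n)) + e n)\<bar> + \<bar>res n / D n\<bar>" by linarith
    also have "\<bar>?\<rho> * (e (Suc (Suc n)) + e n)\<bar> \<le> ?\<rho> * (\<bar>e (Suc (Suc n))\<bar> + \<bar>e n\<bar>)"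
      unfolding abs_mult abs_of_nonneg[OF \<rho>] by (rule mult_left_mono[OF abs_triangle_ineq \<rho>])
    finally have "\<bar>e (Suc n)\<bar> \<le> ?\<rho> * (\<bar>e (Suc (Suc n))\<bar> + \<bar>e n\<bar>) + \<bar>res n / D n\<bar>" by simp
    then have "q (Suc n) \<le> (?\<rho> * (\<bar>e (Suc (Suc n))\<bar> + \<bar>e n\<bar>) + \<bar>res n / D n\<bar>) * Y (Suc n) ^ 7"
      unfolding q_def using Y by (intro mult_right_mono) auto
    also have "\<dots> = ?\<rho> * (\<bar>e (Suc (Suc n))\<bar> * Y (Suc n) ^ 7) + \<kappa> n * q n +
        \<bar>res n * Y (Suc n) ^ 6 * (Y (Suc n) / D n)\<bar>"
    proof -
      have "\<kappa> n * q n = ?\<rho> * \<bar>e n\<bar> * Y (Suc n) ^ 7"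
        using Y by (simp add: \<kappa>_def q_def power_divide)
      moreover have "\<bar>res n * Y (Suc n) ^ 6 * (Y (Suc n) / D n)\<bar> = \<bar>res n / D n\<bar> * Y (Suc n) ^ 7"
        using Y by (simp add: abs_mult abs_divide power_Suc2[of _ 6, simplified])
      ultimately show ?thesis by (simp only: distrib_left distrib_right mult.assoc)
    qed
    \<comment> \<open>\<open>Y\<close> is increasing, so the same factor also serves the right
      neighbour.\<close>
    also have "?\<rho> * (\<bar>e (Suc (Suc n))\<bar> * Y (Suc n) ^ 7) \<le> \<kappa> n * q (Suc (Suc n))"
      unfolding \<kappa>_def q_def
    proof (intro mult_mono)
      have "1 \<le> (Y (Suc n) / Y n) ^ 7" by (rule one_le_power) (use Y Y_le in simp)
      from mult_left_mono[OF this \<rho>]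
      show "?\<rho> \<le> ?\<rho> * (Y (Suc n) / Y n) ^ 7" by (simp only: mult_1_right)
      show "0 \<le> ?\<rho> * (Y (Suc n) / Y n) ^ 7"
        by (rule mult_nonneg_nonneg[OF \<rho>]) (use Y in simp)
      show "Y (Suc n) ^ 7 \<le> Y (Suc (Suc n)) ^ 7" by (rule power_mono) (use Y Y_le in auto)
    qed (use \<rho> Y in auto)
    also have "\<kappa> n * q (Suc (Suc n)) + \<kappa> n * q n + \<bar>res n * Y (Suc n) ^ 6 * (Y (Suc n) / D n)\<bar> \<le>
        1/3 * q (Suc (Suc n)) + 1/3 * q n + C"
      by (intro add_mono mult_right_mono) (use elim Y in \<open>auto simp: q_def\<close>)
    finally show ?case by (simp add: add_divide_distrib)
  qed
  \<comment> \<open>Leading-order agreement of \<beta> and \<open>b\<close> bounds \<open>q\<close>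
    by a multiple of Y^8, well below 2^n.\<close>
  have small: "(\<lambda>n. q n / 2 ^ n) \<longlonglongrightarrow> 0"
  proof (rule Lim_transform_eventually)
    have "(\<lambda>n. Y n ^ 8 / 2 ^ n) \<longlonglongrightarrow> 0" unfolding Y_def by real_asymp
    then have "(\<lambda>n. \<bar>\<beta> n / Y n - b n / Y n\<bar> * (Y n ^ 8 / 2 ^ n)) \<longlonglongrightarrow> \<bar>1/2 - 1/2\<bar> * 0"
      by (intro tendsto_mult tendsto_rabs tendsto_diff \<beta>_asymp b_asymp)
    then show "(\<lambda>n. \<bar>\<beta> n / Y n - b n / Y n\<bar> * (Y n ^ 8 / 2 ^ n)) \<longlonglongrightarrow> 0"
      by simp
    show "\<forall>\<^sub>F n in sequentially. \<bar>\<beta> n / Y n - b n / Y n\<bar> * (Y n ^ 8 / 2 ^ n) = q n / 2 ^ n"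
      using eventually_gt_at_top[of 0]
    proof eventually_elim
      case (elim n)
      then have "Y n > 0" by (rule Y_pos)
      moreover have "\<bar>\<beta> n / Y n - b n / Y n\<bar> = \<bar>e n\<bar> / Y n"
        using \<open>Y n > 0\<close> by (simp add: e_def diff_divide_distrib[symmetric])
      moreover have "Y n ^ 8 = Y n * Y n ^ 7" using power_Suc[of "Y n" 7] by simp
      ultimately show ?case by (simp add: q_def)
    qed
  qed
  obtain N where "\<And>n. n \<ge> N \<Longrightarrow> q (Suc n) \<le> (q (Suc (Suc n)) + q n) / 3 + C"
    using sub by (auto simp: eventually_sequentially)
  from bounded_if_subsolution[OF this small] obtain K where K: "\<And>n. n \<ge> N \<Longrightarrow> q n \<le> K" by blast
  show ?thesis
  proof (rule bigoI)
    show "\<forall>\<^sub>F n in sequentially. norm (\<beta> n - b n) \<le> K * norm (Y n powr (-7))"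
      using eventually_ge_at_top[of N] eventually_gt_at_top[of 0]
    proof eventually_elim
      case (elim n)
      then have "Y n > 0" by (simp add: Y_pos)
      then show ?case using K[OF elim(1)]
        by (simp add: q_def e_def powr_minus powr_numeral field_simps)
    qed
  qed
qed

text \<open>Each \<beta> is replaced by its approximation one at a time. Every replacement costs
  Y^(-7) times cofactors of total size Y^2.\<close>

lemma subleading_asymp:
  "(\<lambda>n. - \<beta> (Suc n) * (real n / 2 + 2 * \<beta> (Suc (Suc n)) * \<beta> n) -
     - freud_approx t 0 (Y (Suc n)) * ((3 * (Y (Suc n))^2 - 1) / 2 +
         2 * freud_approx t 1 (Y (Suc n)) * freud_approx t (-1) (Y (Suc n))))
     \<in> O(\<lambda>n. Y (Suc n) powr (-5))"
proof -
  let ?a = "\<lambda>s n. freud_approx t s (Y (Suc n))"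
  let ?O = "\<lambda>p. O(\<lambda>n. Y (Suc n) powr p)"
  have Y_shift: "(\<lambda>n. Y (Suc (Suc n)) powr (-7)) \<in> ?O (-7)" "(\<lambda>n. Y n powr (-7)) \<in> ?O (-7)"
    unfolding Y_powr by real_asymp+
  have e0: "(\<lambda>n. \<beta> (Suc n) - ?a 0 n) \<in> ?O (-7)"
    using landau_o.big.compose[OF \<beta>_minus_b filterlim_Suc] by (simp add: b_def)
  have "(\<lambda>n. \<beta> (Suc (Suc n)) - b (Suc (Suc n))) \<in> O(\<lambda>n. Y (Suc (Suc n)) powr (-7))"
    using landau_o.big.compose[OF \<beta>_minus_b filterlim_compose[OF filterlim_Suc filterlim_Suc]] .
  from sum_in_bigo(1)[OF landau_o.big_trans[OF this Y_shift(1)] b_Suc_Suc]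
  have e1: "(\<lambda>n. \<beta> (Suc (Suc n)) - ?a 1 n) \<in> ?O (-7)" by simp
  from sum_in_bigo(1)[OF landau_o.big_trans[OF \<beta>_minus_b Y_shift(2)] b_pred]
  have e2: "(\<lambda>n. \<beta> n - ?a (-1) n) \<in> ?O (-7)" by simp
  have small: "f \<in> ?O 1" if "f \<in> ?O (-7)" for f :: "nat \<Rightarrow> real"
    using that by (rule landau_o.big_trans) (rule Y_powr_bigo, simp)
  have \<beta>1: "(\<lambda>n. \<beta> (Suc (Suc n))) \<in> ?O 1"
    using sum_in_bigo(1)[OF small[OF e1] freud_approx_Y_bigo[of 1]] by simp
  have \<beta>2: "(\<lambda>n. \<beta> n) \<in> ?O 1"
    using sum_in_bigo(1)[OF small[OF e2] freud_approx_Y_bigo[of "-1"]] by simp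
  have "(\<lambda>n. real n / 2) \<in> ?O 2" unfolding Y_powr by real_asymp
  from landau_o.big.mult[OF e0 this]
  have 0: "(\<lambda>n. (\<beta> (Suc n) - ?a 0 n) * (real n / 2)) \<in> ?O (-5)"
    unfolding powr_add[symmetric] by simp
  have 1: "(\<lambda>n. (\<beta> (Suc n) - ?a 0 n) * \<beta> (Suc (Suc n)) * \<beta> n) \<in> ?O (-5)"
    using landau_o.big.mult[OF landau_o.big.mult[OF e0 \<beta>1] \<beta>2] unfolding powr_add[symmetric] by simp
  have 2: "(\<lambda>n. (\<beta> (Suc (Suc n)) - ?a 1 n) * ?a 0 n * \<beta> n) \<in> ?O (-5)"
    using landau_o.big.mult[OF landau_o.big.mult[OF e1 freud_approx_Y_bigo[of 0]] \<beta>2]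
    unfolding powr_add[symmetric] by simp
  have 3: "(\<lambda>n. (\<beta> n - ?a (-1) n) * ?a 0 n * ?a 1 n) \<in> ?O (-5)"
    using landau_o.big.mult[OF landau_o.big.mult[OF e2 freud_approx_Y_bigo[of 0]] freud_approx_Y_bigo[of 1]]
    unfolding powr_add[symmetric] by simp
  \<comment> \<open>Telescoping: each summand contains exactly one difference. The form m + 1 - 1
    matches 3 Y^2 - 1 at index \<open>Suc n\<close>.\<close>
  have split: "- x * (m / 2 + 2 * u * v) - - x' * ((m + 1 - 1) / 2 + 2 * u' * v') =
      - 1 * ((x - x') * (m / 2)) + - 2 * ((x - x') * u * v) + - 2 * ((u - u') * x' * v) +
      - 2 * ((v - v') * x' * u')" for x u v x' u' v' m :: real
    by (simp add: field_simps)
  have "(\<lambda>n. - 1 * ((\<beta> (Suc n) - ?a 0 n) * (real n / 2)) + - 2 * ((\<beta> (Suc n) - ?a 0 n) * \<beta> (Suc (Suc n)) * \<beta> n)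
     + - 2 * ((\<beta> (Suc (Suc n)) - ?a 1 n) * ?a 0 n * \<beta> n)
     + - 2 * ((\<beta> n - ?a (-1) n) * ?a 0 n * ?a 1 n)) \<in> ?O (-5)"
    by (intro sum_in_bigo cmult_bigo 0 1 2 3)
  moreover have "- \<beta> (Suc n) * (real n / 2 + 2 * \<beta> (Suc (Suc n)) * \<beta> n) -
     - ?a 0 n * ((3 * (Y (Suc n))^2 - 1) / 2 + 2 * ?a 1 n * ?a (-1) n) =
     - 1 * ((\<beta> (Suc n) - ?a 0 n) * (real n / 2)) + - 2 * ((\<beta> (Suc n) - ?a 0 n) * \<beta> (Suc (Suc n)) * \<beta> n)
     + - 2 * ((\<beta> (Suc (Suc n)) - ?a 1 n) * ?a 0 n * \<beta> n)
     + - 2 * ((\<beta> n - ?a (-1) n) * ?a 0 n * ?a 1 n)" for n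
    unfolding Y_square of_nat_Suc add.commute[of 1] by (rule split)
  ultimately show ?thesis by (simp only:)
qed

end

section \<open>Conclusion in powers of n\<close>

lemma bigo_sequentially_SucD:
  fixes f g :: "nat \<Rightarrow> real"
  assumes "(\<lambda>n. f (Suc n)) \<in> O(\<lambda>n. g (Suc n))"
  shows "f \<in> O(g)"
proof -
  obtain c where "\<forall>\<^sub>F n in sequentially. norm (f (Suc n)) \<le> c * norm (g (Suc n))"
    using assms by (rule landau_o.bigE)
  then show ?thesis
    by (intro bigoI[of _ c]) (subst (asm) eventually_sequentially_Suc)
qed

theorem theorem2p2:
  fixes t :: real and P :: "nat \<Rightarrow> real poly"
  assumes "monic_orthogonal_polys (quartic_weight t) P"
  shows "(\<lambda>n. subleading_coeff P n -
           (- (real n powr (3/2) / (3 * sqrt 3))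
            - real n * t / 12
            - (t^2 - 6) * real n powr (1/2) / (24 * sqrt 3)
            - t * (t^2 - 9) / 216
            - (t^4 - 12 * t^2 - 24) / (1152 * sqrt 3 * real n powr (1/2))
            + t / (288 * real n)
            + (t^6 - 18 * t^4 - 72 * t^2 + 864) / (82944 * sqrt 3 * real n powr (3/2))
            - t * (t^2 - 6) / (3456 * real n ^ 2)))
         \<in> O[sequentially](\<lambda>n. real n powr (- (5/2)))"
proof -
  obtain h where "\<And>n. h n > 0" and
    "\<And>j k. has_bochner_integral lborel (\<lambda>x. poly (P j) x * poly (P k) x * quartic_weight t x)
      (if j = k then h j else 0)"
    using assms unfolding monic_orthogonal_polys_def by blast
  moreover have "degree (P n) = n" "lead_coeff (P n) = 1" for n
    using assms unfolding monic_orthogonal_polys_def by blast+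
  ultimately interpret even_quartic_functional
    "\<lambda>q. \<integral>x. poly q x * quartic_weight t x \<partial>lborel" t P h
    by (intro orthogonal_polys_functional)
  interpret freud_recurrence \<beta> t
  proof
    show "\<beta> n > 0" for n by (rule \<beta>_pos)
    show "4 * \<beta> (Suc n) * (\<beta> (Suc (Suc n)) + \<beta> (Suc n) + \<beta> n) - 2 * t * \<beta> (Suc n) = real (Suc n)"
      if "n \<ge> 1" for n
      using freud_equation[of "n - 1"] that by simp
  qed
  \<comment> \<open>The claimed expansion in y = sqrt (n/3); for instance 1152 sqrt 3 n^(1/2) = 3456
    y and 82944 sqrt 3 n^(3/2) = 746496 y^3.\<close>
  define c where "c y = - (y^3) - t * y^2 / 4 - (t^2 - 6) * y / 24 - t * (t^2 - 9) / 216 -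
    (t^4 - 12 * t^2 - 24) / (3456 * y) + t / (864 * y^2) +
    (t^6 - 18 * t^4 - 72 * t^2 + 864) / (746496 * y^3) - t * (t^2 - 6) / (31104 * y^4)" for y :: real
  let ?p = "\<lambda>n. - \<beta> (Suc n) * (real n / 2 + 2 * \<beta> (Suc (Suc n)) * \<beta> n)"
  have "(\<lambda>n. ?p n - c (Y (Suc n))) \<in> O(\<lambda>n. Y (Suc n) powr (-5))"
    using sum_in_bigo(1)[OF subleading_asymp
        landau_o.big.compose[OF freud_approx_subleading[of t] Y_Suc_at_top]]
    by (simp only: c_def diff_add_cancel add_diff_eq)
  moreover have "\<forall>\<^sub>F n in sequentially. ?p n - c (Y (Suc n)) = subleading_coeff P (Suc n) - c (Y (Suc n))"
    using eventually_ge_at_top[of 1]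
  proof eventually_elim
    case (elim n)
    then show ?case using coeff_P_eq_\<beta>[of "n - 1"] by (simp add: subleading_coeff_def)
  qed
  ultimately have "(\<lambda>n. subleading_coeff P (Suc n) - c (Y (Suc n))) \<in> O(\<lambda>n. Y (Suc n) powr (-5))"
    by (subst landau_o.big.in_cong[symmetric])
  then have "(\<lambda>n. subleading_coeff P n - c (Y n)) \<in> O(\<lambda>n. Y n powr (-5))"
    by (rule bigo_sequentially_SucD)
  also have "(\<lambda>n. Y n powr (-5)) \<in> O(\<lambda>n. real n powr (- (5/2)))"
    unfolding Y_powr by real_asymp
  finally have *: "(\<lambda>n. subleading_coeff P n - c (Y n)) \<in> O(\<lambda>n. real n powr (- (5/2)))" .
  have "\<forall>\<^sub>F n in sequentially. c (Y n) =
      - (real n powr (3/2) / (3 * sqrt 3)) - real n * t / 12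
      - (t^2 - 6) * real n powr (1/2) / (24 * sqrt 3) - t * (t^2 - 9) / 216
      - (t^4 - 12 * t^2 - 24) / (1152 * sqrt 3 * real n powr (1/2)) + t / (288 * real n)
      + (t^6 - 18 * t^4 - 72 * t^2 + 864) / (82944 * sqrt 3 * real n powr (3/2))
      - t * (t^2 - 6) / (3456 * real n ^ 2)"
    using eventually_gt_at_top[of 0]
  proof eventually_elim
    case (elim n)
    \<comment> \<open>Half-integer powers of n are \<open>r\<close> times polynomials in
      \<open>Y n\<close>, so every root disappears through \<open>r * r = 3\<close> or by
      cancellation.\<close>
    define r where "r = sqrt 3"
    have r: "r > 0" "r * r = 3" by (simp_all add: r_def)
    have y: "Y n > 0" using elim by (rule Y_pos)
    have n: "real n = 3 * (Y n)^2" by (simp only: Y_square)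
    have half: "real n powr (1/2) = r * Y n"
      by (simp add: powr_half_sqrt Y_def r_def flip: real_sqrt_mult)
    have three_half: "real n powr (3/2) = r * (3 * (Y n)^3)"
      using powr_add[of "real n" 1 "1/2"] elim
      by (simp add: half power3_eq_cube power2_eq_square flip: n) (simp add: n power2_eq_square)
    have rr: "u * r * (r * v) = 3 * (u * v)" for u v
    proof -
      have "u * r * (r * v) = (r * r) * (u * v)" by (simp only: ac_simps)
      then show ?thesis by (simp only: r(2))
    qed
    have r_cancel: "r * (3 * (Y n)^3) / (3 * r) = (Y n)^3" "x * (r * Y n) / (24 * r) = x * Y n / 24" for x
      using r(1) by simp_all
    have "(3 * (Y n)^2)^2 = 9 * (Y n)^4" by (simp add: power_mult_distrib flip: power_mult)
    then show ?case
      unfolding c_def r_def[symmetric] half three_half r_cancel rr unfolding n by simp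
  qed
  then have "\<forall>\<^sub>F n in sequentially. subleading_coeff P n - c (Y n) = subleading_coeff P n - (
      - (real n powr (3/2) / (3 * sqrt 3)) - real n * t / 12
      - (t^2 - 6) * real n powr (1/2) / (24 * sqrt 3) - t * (t^2 - 9) / 216
      - (t^4 - 12 * t^2 - 24) / (1152 * sqrt 3 * real n powr (1/2)) + t / (288 * real n)
      + (t^6 - 18 * t^4 - 72 * t^2 + 864) / (82944 * sqrt 3 * real n powr (3/2))
      - t * (t^2 - 6) / (3456 * real n ^ 2))"
    by eventually_elim simp
  from landau_o.big.in_cong[OF this] * show ?thesis by simp
qed

end
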